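(* The set $\{X\in M_2 : X^2=-I_2\}$ of real skew-involutory matrices of order $2$ is a hyperboloid of two sheets.
   Context: $M_2$ is the set of real $2\times 2$ matrices and $I_2$ is the identity matrix. A matrix $X=\begin{bmatrix} x_1 & x_2 \\ x_3 & x_4 \end{bmatrix}\in M_2$ is identified with the point $(x_1,x_2,x_3,x_4)$ of Euclidean space $\mathbb R^4$. A subset of $\mathbb R^4$ is called a hyperboloid of two sheets if it is contained in some three-dimensional affine subspace (hyperplane) $H$ of $\mathbb R^4$ and, with respect to some rectangular (orthonormal) Cartesian coordinate system $(x,y,z)$ on $H$, it is exactly the set of points of $H$ satisfying $\frac{x^2}{a^2}+\frac{y^2}{b^2}-\frac{z^2}{c^2}=-1$ for some $a,b,c>0$. *)

theory Defs
  imports "HOL-Analysis.Analysis"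
begin

definition matrix_point :: "real^2^2 \<Rightarrow> real^4" where
  "matrix_point X = vector [X $ 1 $ 1, X $ 1 $ 2, X $ 2 $ 1, X $ 2 $ 2]"

text \<open>The point with coordinates (x,y,z) is \<open>p + x *\<^sub>R e1 + y *\<^sub>R e2 + z *\<^sub>R e3\<close>.\<close>

definition rectangular_coords_on ::
    "(real^4) set \<Rightarrow> real^4 \<Rightarrow> real^4 \<Rightarrow> real^4 \<Rightarrow> real^4 \<Rightarrow> bool" where
  "rectangular_coords_on H p e1 e2 e3 \<longleftrightarrow>
     norm e1 = 1 \<and> norm e2 = 1 \<and> norm e3 = 1 \<and>
     e1 \<bullet> e2 = 0 \<and> e1 \<bullet> e3 = 0 \<and> e2 \<bullet> e3 = 0 \<and>
     H = {p + x *\<^sub>R e1 + y *\<^sub>R e2 + z *\<^sub>R e3 | x y z. True}"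

definition hyperboloid_of_two_sheets :: "(real^4) set \<Rightarrow> bool" where
  "hyperboloid_of_two_sheets S \<longleftrightarrow>
     (\<exists>H p e1 e2 e3 a b c.
        affine H \<and> aff_dim H = 3 \<and> rectangular_coords_on H p e1 e2 e3 \<and>
        a > 0 \<and> b > 0 \<and> c > 0 \<and>
        S = {p + x *\<^sub>R e1 + y *\<^sub>R e2 + z *\<^sub>R e3 | x y z.
               x^2 / a^2 + y^2 / b^2 - z^2 / c^2 = -1})"

text \<open>Powers of the type \<open>real^2^2\<close> are componentwise, so the square of a matrix is
  written with the matrix product \<open>**\<close>.\<close>

definition skew_involutory :: "real^'n^'n \<Rightarrow> bool" where
  "skew_involutory X \<longleftrightarrow> X ** X = - mat 1"

end

theory Submission
  imports Defs
begin

text \<open>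
  For a real matrix with rows \<open>(p, q)\<close> and \<open>(r, s)\<close>, the equation \<open>X\<^sup>2 = -I\<close> is equivalent to
  \<open>p + s = 0\<close> and \<open>p\<^sup>2 + q r = -1\<close>: if the trace did not vanish, the off-diagonal equations
  \<open>q (p + s) = r (p + s) = 0\<close> would give \<open>q = r = 0\<close> and hence \<open>p\<^sup>2 = -1\<close>
  (lemma \<open>skew_involutory_2_iff\<close>).
  So the set lies in the hyperplane of traceless matrices.  The quadratic form \<open>p\<^sup>2 + q r\<close> is
  diagonalised there by three pairwise orthogonal directions: the traceless diagonal matrices,
  the symmetric off-diagonal ones and the skew-symmetric ones.
  With coordinates \<open>p = x / \<surd>2\<close>, \<open>q = (y + z) / \<surd>2\<close>, \<open>r = (y - z) / \<surd>2\<close> it becomes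
  \<open>x\<^sup>2 / 2 + y\<^sup>2 / 2 - z\<^sup>2 / 2\<close>, so all three semi-axes equal \<open>\<surd>2\<close>.
\<close>

lemma vector_4:
  "(vector [w, x, y, z] :: 'a::zero^4) $ 1 = w"
  "(vector [w, x, y, z] :: 'a::zero^4) $ 2 = x"
  "(vector [w, x, y, z] :: 'a::zero^4) $ 3 = y"
  "(vector [w, x, y, z] :: 'a::zero^4) $ 4 = z"
  unfolding vector_def by simp_all

lemma inner_4: "x \<bullet> y = x$1 * y$1 + x$2 * y$2 + x$3 * y$3 + x$4 * y$4"
  for x y :: "real^4"
  by (simp add: inner_vec_def sum_4)

lemma skew_involutory_2_iff:
  fixes X :: "real^2^2"
  shows "skew_involutory X \<longleftrightarrow> X$1$1 + X$2$2 = 0 \<and> (X$1$1)\<^sup>2 + X$1$2 * X$2$1 = -1"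
proof -
  have entries: "skew_involutory X \<longleftrightarrow>
      X$1$1 * X$1$1 + X$1$2 * X$2$1 = -1 \<and> X$1$1 * X$1$2 + X$1$2 * X$2$2 = 0 \<and>
      X$2$1 * X$1$1 + X$2$2 * X$2$1 = 0 \<and> X$2$1 * X$1$2 + X$2$2 * X$2$2 = -1"
    by (simp add: skew_involutory_def vec_eq_iff forall_2 matrix_matrix_mult_def sum_2 mat_def)
  have trace_zero: "p + s = 0"
    if "p * p + q * r = -1" "p * q + q * s = 0" for p q r s :: real
  proof (rule ccontr)
    assume "p + s \<noteq> 0"
    moreover have "q * (p + s) = 0"
      using that(2) by (simp add: algebra_simps)
    ultimately have "p * p = -1"
      using that(1) by simp
    then show False
      using zero_le_square[of p] by linarith
  qed
  show ?thesis
  proof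
    assume "skew_involutory X"
    then show "X$1$1 + X$2$2 = 0 \<and> (X$1$1)\<^sup>2 + X$1$2 * X$2$1 = -1"
      using trace_zero[of "X$1$1" "X$1$2" "X$2$1" "X$2$2"]
      by (simp add: entries power2_eq_square)
  next
    assume "X$1$1 + X$2$2 = 0 \<and> (X$1$1)\<^sup>2 + X$1$2 * X$2$1 = -1"
    moreover from this have "X$2$2 = - X$1$1"
      by simp
    ultimately show "skew_involutory X"
      by (simp add: entries power2_eq_square algebra_simps)
  qed
qed

lemma matrix_point_image_skew_involutory:
  "matrix_point ` {X. skew_involutory X} = {v. v$1 + v$4 = 0 \<and> (v$1)\<^sup>2 + v$2 * v$3 = -1}"
proof (intro equalityI subsetI)
  fix v assume "v \<in> matrix_point ` {X. skew_involutory X}"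
  then show "v \<in> {v. v$1 + v$4 = 0 \<and> (v$1)\<^sup>2 + v$2 * v$3 = -1}"
    by (auto simp: matrix_point_def skew_involutory_2_iff vector_4)
next
  fix v :: "real^4"
  assume v: "v \<in> {v. v$1 + v$4 = 0 \<and> (v$1)\<^sup>2 + v$2 * v$3 = -1}"
  define X :: "real^2^2" where "X = vector [vector [v$1, v$2], vector [v$3, v$4]]"
  have "v = matrix_point X"
    by (simp add: matrix_point_def X_def vec_eq_iff forall_4 vector_4)
  moreover have "skew_involutory X"
    using v by (simp add: skew_involutory_2_iff X_def)
  ultimately show "v \<in> matrix_point ` {X. skew_involutory X}"
    by blast
qed

theorem mainTheorem5:
  shows "hyperboloid_of_two_sheets (matrix_point ` {X :: real^2^2. skew_involutory X})"
proof -
  define t :: real where "t = 1 / sqrt 2"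
  have t2: "t * t = 1 / 2"
    by (simp add: t_def)
  define H :: "(real^4) set" where "H = {v. v$1 + v$4 = 0}"
  define e1 :: "real^4" where "e1 = vector [t, 0, 0, -t]"
  define e2 :: "real^4" where "e2 = vector [0, t, t, 0]"
  define e3 :: "real^4" where "e3 = vector [0, t, -t, 0]"
  note e_defs = e1_def e2_def e3_def vector_4
  \<comment> \<open>The centre is the origin; it is kept as a summand so that \<open>P\<close> unfolds to the point
    \<open>p + x *\<^sub>R e1 + y *\<^sub>R e2 + z *\<^sub>R e3\<close> with \<open>p = 0\<close>.\<close>
  define P where "P x y z = 0 + x *\<^sub>R e1 + y *\<^sub>R e2 + z *\<^sub>R e3" for x y z
  have P_nth: "P x y z $ 1 = x * t" "P x y z $ 2 = (y + z) * t"
    "P x y z $ 3 = (y - z) * t" "P x y z $ 4 = - x * t" for x y z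
    by (simp_all add: P_def e_defs algebra_simps)

  have H_eq: "H = {v. vector [1, 0, 0, 1] \<bullet> v = 0}"
    by (simp add: H_def inner_4 vector_4)
  have "(vector [1, 0, 0, 1] :: real^4) \<noteq> 0"
    by (simp add: vec_eq_iff forall_4 vector_4)
  then have "affine H" "aff_dim H = 3"
    by (simp_all add: H_eq affine_hyperplane aff_dim_hyperplane)

  have coords_exist: "\<exists>x y z. v = P x y z" if "v \<in> H" for v
  proof -
    have "v$4 = - v$1"
      using that by (simp add: H_def)
    moreover have "u * (t * 2) * t = u" for u
      using t2 by (simp add: mult.assoc mult.left_commute)
    \<comment> \<open>The coordinates are the inner products of \<open>v\<close> with \<open>e1\<close>, \<open>e2\<close> and \<open>e3\<close>;
      the first one is \<open>t * (v$1 - v$4)\<close>.\<close>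
    ultimately have "v = P (v$1 * (t * 2)) ((v$2 + v$3) * t) ((v$2 - v$3) * t)"
      using t2 by (simp add: vec_eq_iff forall_4 P_nth algebra_simps)
    then show ?thesis
      by blast
  qed
  have P_in_H: "P x y z \<in> H" for x y z
    by (simp add: H_def P_nth)

  have "H = {P x y z | x y z. True}"
    using coords_exist P_in_H by blast
  moreover have "norm e1 = 1" "norm e2 = 1" "norm e3 = 1"
    using t2 by (simp_all add: norm_eq_1 inner_4 e_defs)
  moreover have "e1 \<bullet> e2 = 0" "e1 \<bullet> e3 = 0" "e2 \<bullet> e3 = 0"
    by (simp_all add: inner_4 e_defs)
  ultimately have "rectangular_coords_on H 0 e1 e2 e3"
    unfolding rectangular_coords_on_def P_def by blast

  have form: "(P x y z $ 1)\<^sup>2 + P x y z $ 2 * P x y z $ 3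
      = x\<^sup>2 / (sqrt 2)\<^sup>2 + y\<^sup>2 / (sqrt 2)\<^sup>2 - z\<^sup>2 / (sqrt 2)\<^sup>2" for x y z
  proof -
    have "(P x y z $ 1)\<^sup>2 + P x y z $ 2 * P x y z $ 3 = (x\<^sup>2 + y\<^sup>2 - z\<^sup>2) * (t * t)"
      by (simp add: P_nth power2_eq_square algebra_simps)
    then show ?thesis
      by (simp add: t2 field_simps)
  qed
  have "matrix_point ` {X. skew_involutory X} = {v \<in> H. (v$1)\<^sup>2 + v$2 * v$3 = -1}"
    by (simp add: matrix_point_image_skew_involutory H_def)
  also have "\<dots> = {P x y z | x y z.
      x\<^sup>2 / (sqrt 2)\<^sup>2 + y\<^sup>2 / (sqrt 2)\<^sup>2 - z\<^sup>2 / (sqrt 2)\<^sup>2 = -1}"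
    unfolding form[symmetric] using coords_exist P_in_H by blast
  finally have "matrix_point ` {X. skew_involutory X} = {P x y z | x y z.
      x\<^sup>2 / (sqrt 2)\<^sup>2 + y\<^sup>2 / (sqrt 2)\<^sup>2 - z\<^sup>2 / (sqrt 2)\<^sup>2 = -1}" .
  moreover have "sqrt 2 > 0"
    by simp
  ultimately show ?thesis
    using \<open>affine H\<close> \<open>aff_dim H = 3\<close> \<open>rectangular_coords_on H 0 e1 e2 e3\<close>
    unfolding hyperboloid_of_two_sheets_def P_def by blast
qed

end
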